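(* Let $c\ge2$ be a fixed integer and let $\{G_n\}_{n\ge1}$ be a sequence of finite simple graphs with $N(K_3,G_n)\ge1$ for all $n$. If $Z_3(G_n)$ converges in distribution to $N(0,1)$ as $n\to\infty$, then $\mathbb{E}(Z_3(G_n)^4)\to3$ as $n\to\infty$.
   Context: $G_n=(V(G_n),E(G_n))$ is a deterministic finite simple graph with vertex set $\{1,2,\dots,|V(G_n)|\}$ and adjacency matrix $(a_{ij}(G_n))$. In a uniformly random $c$-coloring, the colors $X_v$, $v\in V(G_n)$, are independent and uniform on $\{1,\dots,c\}$. The number of monochromatic triangles is $$T_3(G_n)=\sum_{1\le s_1<s_2<s_3\le |V(G_n)|}a_{s_1s_2}(G_n)a_{s_2s_3}(G_n)a_{s_1s_3}(G_n)\mathbf 1\{X_{s_1}=X_{s_2}=X_{s_3}\},$$ and $Z_3(G_n)=\dfrac{T_3(G_n)-\mathbb{E}(T_3(G_n))}{\sqrt{\mathrm{Var}(T_3(G_n))}}$. $N(K_3,G_n)$ is the number of triangles in $G_n$. *)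

theory Defs
  imports "HOL-Probability.Probability" "Graph_Theory.Pair_Digraph"
begin

text \<open>
  A finite simple graph on vertices of type \<^typ>\<open>nat\<close> is a \<^typ>\<open>nat pair_pre_digraph\<close>
  satisfying the locale \<^locale>\<open>pair_graph\<close> (finite, irreflexive, symmetric arc relation).
\<close>

definition adjacency :: "nat pair_pre_digraph \<Rightarrow> nat \<Rightarrow> nat \<Rightarrow> real" where
  "adjacency G i j = of_bool ((i, j) \<in> parcs G)"

definition num_triangles :: "nat pair_pre_digraph \<Rightarrow> nat" where
  "num_triangles G =
     card {S. S \<subseteq> pverts G \<and> card S = 3 \<and> (\<forall>u\<in>S. \<forall>v\<in>S. u \<noteq> v \<longrightarrow> (u, v) \<in> parcs G)}"

text \<open>
  The joint law of the vertex colors. Outside the vertex set a coloring takes the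
  dummy value \<^const>\<open>undefined\<close>, which never enters the statistics below.
\<close>

definition coloring_pmf :: "nat \<Rightarrow> nat pair_pre_digraph \<Rightarrow> (nat \<Rightarrow> nat) pmf" where
  "coloring_pmf c G = Pi_pmf (pverts G) undefined (\<lambda>_. pmf_of_set {1..c})"

text \<open>
  The index range presupposes that the vertex set is \<open>{1..card (pverts G)}\<close>.
\<close>

definition T3 :: "nat pair_pre_digraph \<Rightarrow> (nat \<Rightarrow> nat) \<Rightarrow> real" where
  "T3 G X =
     (\<Sum>(s1, s2, s3) | 1 \<le> s1 \<and> s1 < s2 \<and> s2 < s3 \<and> s3 \<le> card (pverts G).
        adjacency G s1 s2 * adjacency G s2 s3 * adjacency G s1 s3
          * of_bool (X s1 = X s2 \<and> X s2 = X s3))"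

definition Z3 :: "nat \<Rightarrow> nat pair_pre_digraph \<Rightarrow> (nat \<Rightarrow> nat) \<Rightarrow> real" where
  "Z3 c G X =
     (T3 G X - measure_pmf.expectation (coloring_pmf c G) (T3 G))
       / sqrt (measure_pmf.variance (coloring_pmf c G) (T3 G))"

end

theory Submission
  imports Defs
begin

text \<open>
  Convergence in distribution gives convergence of expectations of bounded continuous
  functions; to reach the unbounded function \<open>x ^ 4\<close> one needs uniform integrability, and
  for this a bound on the eighth moments of \<^const>\<open>Z3\<close> that does not depend on the graph is
  enough.

  Such a bound exists because \<^const>\<open>Z3\<close> is a polynomial of degree 3 in independent
  variables: it is a sum of functions each of which looks at no more than three vertex colors.
  On a product of probability spaces whose atoms all have mass at least \<open>l\<close>, a function \<open>f\<close> of
  degree at most \<open>d\<close> satisfies the hypercontractive inequality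
  \<open>E (f ^ 4) \<le> (16 / l) ^ d * (E (f ^ 2)) ^ 2\<close> (\<open>Bonami_hypercontractivity\<close>), where the
  constant depends neither on the number of factors nor on the number of terms of \<open>f\<close>.
  Here \<open>l = 1 / c\<close>. Applied to the square of \<^const>\<open>Z3\<close>, of degree 6, it bounds the eighth
  moment by the fourth; applied to \<^const>\<open>Z3\<close> itself it bounds the fourth moment by the second,
  which the normalization keeps at most 1.

  The inequality is proved by adding one coordinate at a time. Averaging over the new
  coordinate splits \<open>f\<close> into \<open>g + h\<close>, where \<open>g\<close> no longer depends on that coordinate and \<open>h\<close>
  has conditional mean 0; for each value of the new coordinate \<open>h\<close> has degree at most \<open>d - 1\<close>,
  which yields the factor that pays for the mixed terms of \<open>(g + h) ^ 4\<close>.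
\<close>

section \<open>Low-degree functions of many coordinates\<close>

text \<open>
  Degree is understood in the sense of the Efron-Stein decomposition: a sum of functions
  that depend on at most \<open>d\<close> coordinates each. Over finite alphabets these play the part of
  polynomials of degree \<open>d\<close>.
\<close>

inductive degree_le :: "nat \<Rightarrow> (('i \<Rightarrow> 'a) \<Rightarrow> real) \<Rightarrow> bool" where
  junta: "\<lbrakk>finite S; card S \<le> d; \<And>x y. (\<And>s. s \<in> S \<Longrightarrow> x s = y s) \<Longrightarrow> f x = f y\<rbrakk> \<Longrightarrow> degree_le d f"
| add: "\<lbrakk>degree_le d f; degree_le d g\<rbrakk> \<Longrightarrow> degree_le d (\<lambda>x. f x + g x)"

lemma degree_le_const: "degree_le d (\<lambda>_. c)"
  by (rule degree_le.junta[of "{}"]) auto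

lemma degree_le_sum:
  assumes "\<And>k. k \<in> K \<Longrightarrow> degree_le d (f k)"
  shows "degree_le d (\<lambda>x. \<Sum>k\<in>K. f k x)"
  using assms by (induction K rule: infinite_finite_induct) (auto intro: degree_le_const degree_le.add)

lemma degree_le_mult_junta:
  assumes "degree_le e g" and "finite S" "card S \<le> d"
    and "\<And>x y. (\<And>s. s \<in> S \<Longrightarrow> x s = y s) \<Longrightarrow> f x = f y"
  shows "degree_le (d + e) (\<lambda>x. f x * g x)"
  using assms(1)
proof (induction rule: degree_le.induct)
  case (junta T e g)
  show ?case
  proof (rule degree_le.junta)
    show "finite (S \<union> T)" "card (S \<union> T) \<le> d + e"
      using card_Un_le[of S T] junta(1,2) assms(2,3) by auto
    show "f x * g x = f y * g y" if eq: "\<And>s. s \<in> S \<union> T \<Longrightarrow> x s = y s" for x y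
    proof -
      have "f x = f y" by (rule assms(4)) (simp add: eq)
      moreover have "g x = g y" by (rule junta(3)) (simp add: eq)
      ultimately show ?thesis by simp
    qed
  qed
next
  case (add e g g')
  then show ?case
    using degree_le.add[OF add.IH] by (simp add: distrib_left)
qed

lemma degree_le_mult:
  assumes "degree_le d f" and "degree_le e g"
  shows "degree_le (d + e) (\<lambda>x. f x * g x)"
  using assms(1)
proof (induction rule: degree_le.induct)
  case (junta S d f)
  show ?case
    by (rule degree_le_mult_junta[OF assms(2) junta])
next
  case (add d f f')
  then show ?case
    using degree_le.add[OF add.IH] by (simp add: distrib_right)
qed

lemma degree_le_cmult: "degree_le d f \<Longrightarrow> degree_le d (\<lambda>x. c * f x)"
  using degree_le_mult[OF degree_le_const[of 0 c], of d f] by simp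

lemma degree_le_fun_upd:
  assumes "degree_le d f"
  shows "degree_le d (\<lambda>x. f (x(v := a)))"
  using assms
proof (induction rule: degree_le.induct)
  case (junta S d f)
  show ?case
    by (rule degree_le.junta[OF junta(1,2)]) (auto intro!: junta(3))
qed (rule degree_le.add)

text \<open>
  A discrete derivative lowers the degree, as for polynomials: the terms without the
  coordinate \<open>v\<close> cancel, and in the others \<open>v\<close> is no longer free. For \<open>d = 0\<close> the truncated
  subtraction is harmless, since the difference vanishes.
\<close>

lemma degree_le_diff:
  assumes "degree_le d f"
  shows "degree_le (d - 1) (\<lambda>x. f (x(v := a)) - f (x(v := b)))"
  using assms
proof (induction rule: degree_le.induct)
  case (junta S d f)
  show ?case
  proof (cases "v \<in> S")
    case True
    have dependence: "f (x(v := a)) - f (x(v := b)) = f (y(v := a)) - f (y(v := b))"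
      if eq: "\<And>s. s \<in> S - {v} \<Longrightarrow> x s = y s" for x y
    proof -
      have "f (x(v := z)) = f (y(v := z))" for z
        by (rule junta(3)) (simp add: eq)
      then show ?thesis by simp
    qed
    show ?thesis
    proof (rule degree_le.junta)
      show "finite (S - {v})" "card (S - {v}) \<le> d - 1"
        using junta(1,2) True by simp_all
    qed (rule dependence)
  next
    case False
    have "f (x(v := a)) = f (x(v := b))" for x
      by (rule junta(3)) (use False in auto)
    then have "(\<lambda>x. f (x(v := a)) - f (x(v := b))) = (\<lambda>_. 0)"
      by (simp only: diff_self)
    then show ?thesis
      by (simp only: degree_le_const)
  qed
next
  case (add d f g)
  then show ?case
    using degree_le.add[OF add.IH] by (simp add: algebra_simps)
qed

lemma degree_le_0_const:
  assumes "degree_le 0 f"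
  shows "f x = f y"
proof -
  have "d = 0 \<Longrightarrow> f x = f y" if "degree_le d f" for d
    using that
  proof (induction rule: degree_le.induct)
    case (junta S d f)
    then show ?case by (intro junta(3)) auto
  qed auto
  with assms show ?thesis by blast
qed

section \<open>Hypercontractivity on finite product spaces\<close>

lemma pmf_Cauchy_Schwarz:
  fixes f g :: "'x \<Rightarrow> real"
  assumes "finite (set_pmf q)"
  shows "(measure_pmf.expectation q (\<lambda>x. f x * g x))\<^sup>2
    \<le> measure_pmf.expectation q (\<lambda>x. (f x)\<^sup>2) * measure_pmf.expectation q (\<lambda>x. (g x)\<^sup>2)"
proof -
  have E: "measure_pmf.expectation q h = (\<Sum>x\<in>set_pmf q. h x * pmf q x)" for h :: "'x \<Rightarrow> real"
    by (rule integral_measure_pmf_real[OF assms])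
  show ?thesis
    unfolding E
    using Cauchy_Schwarz_ineq_sum[of "\<lambda>x. f x * sqrt (pmf q x)" "\<lambda>x. g x * sqrt (pmf q x)" "set_pmf q"]
    by (simp add: power_mult_distrib algebra_simps)
qed

text \<open>
  The inductive step: \<open>w\<close> is the law of the new coordinate, \<open>q\<close> that of the old ones, and \<open>g + h a\<close>
  is the given function when the new coordinate equals \<open>a\<close>. The hypothesis on \<open>h\<close> is better than
  the one on \<open>g\<close> by a factor \<open>16 / l\<close>. Write \<open>V\<close> and \<open>H\<close> for the second moments of \<open>g\<close> and \<open>h\<close>,
  so that the right-hand side contains \<open>(V + H)\<^sup>2 = V\<^sup>2 + 2 V H + H\<^sup>2\<close>. The terms of
  \<open>(g + h) ^ 4\<close> are matched with these three: \<open>g ^ 4\<close> with \<open>V\<^sup>2\<close>; \<open>g\<^sup>2 h\<^sup>2\<close> with \<open>V H\<close>, by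
  Cauchy-Schwarz; and \<open>h ^ 4\<close> with \<open>H\<^sup>2\<close>. The term \<open>g ^ 3 h\<close> vanishes in the mean, and \<open>g h ^ 3\<close>
  is absorbed by its neighbours.
\<close>

lemma hypercontractive_step:
  fixes w :: "'a \<Rightarrow> real" and q :: "'x pmf" and g :: "'x \<Rightarrow> real" and h :: "'a \<Rightarrow> 'x \<Rightarrow> real"
  assumes S: "finite S" "(\<Sum>a\<in>S. w a) = 1" and l: "0 < l" "\<And>a. a \<in> S \<Longrightarrow> l \<le> w a"
    and q: "finite (set_pmf q)"
    and mean: "\<And>x. (\<Sum>a\<in>S. w a * h a x) = 0"
    and B: "0 \<le> B"
    and g4: "measure_pmf.expectation q (\<lambda>x. g x ^ 4) \<le> 16 / l * B * (measure_pmf.expectation q (\<lambda>x. (g x)\<^sup>2))\<^sup>2"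
    and h4: "\<And>a. a \<in> S \<Longrightarrow> measure_pmf.expectation q (\<lambda>x. h a x ^ 4) \<le> B * (measure_pmf.expectation q (\<lambda>x. (h a x)\<^sup>2))\<^sup>2"
  shows "(\<Sum>a\<in>S. w a * measure_pmf.expectation q (\<lambda>x. (g x + h a x) ^ 4))
    \<le> 16 / l * B * (\<Sum>a\<in>S. w a * measure_pmf.expectation q (\<lambda>x. (g x + h a x)\<^sup>2))\<^sup>2"
proof -
  let ?E = "measure_pmf.expectation q"
  have int [simp]: "integrable (measure_pmf q) f" for f :: "'x \<Rightarrow> real"
    by (rule integrable_measure_pmf_finite[OF q])
  define H where "H = (\<Sum>a\<in>S. w a * ?E (\<lambda>x. (h a x)\<^sup>2))"
  define V where "V = ?E (\<lambda>x. (g x)\<^sup>2)"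
  have w0: "0 \<le> w a" if "a \<in> S" for a
    using l that by force
  have V0: "0 \<le> V" and s0: "0 \<le> ?E (\<lambda>x. (h a x)\<^sup>2)" for a
    by (auto simp: V_def)
  have H0: "0 \<le> H"
    unfolding H_def by (intro sum_nonneg mult_nonneg_nonneg w0 s0)
  have "B \<le> B * (1 / l)"
  proof -
    obtain a where "a \<in> S" using S by fastforce
    have "w a \<le> (\<Sum>a\<in>S. w a)" by (rule member_le_sum) (use \<open>a \<in> S\<close> S w0 in auto)
    with l(2)[OF \<open>a \<in> S\<close>] S l(1) have "1 \<le> 1 / l" by simp
    from mult_left_mono[OF this B] show ?thesis by simp
  qed
  have vanish: "(\<Sum>a\<in>S. w a * ?E (\<lambda>x. k x * h a x)) = 0" for k :: "'x \<Rightarrow> real"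
  proof -
    have "(\<Sum>a\<in>S. w a * ?E (\<lambda>x. k x * h a x)) = ?E (\<lambda>x. \<Sum>a\<in>S. w a * (k x * h a x))"
      by (subst Bochner_Integration.integral_sum) auto
    also have "\<dots> = ?E (\<lambda>x. k x * (\<Sum>a\<in>S. w a * h a x))"
      by (simp add: sum_distrib_left mult_ac)
    finally show ?thesis by (simp add: mean)
  qed
  have second: "(\<Sum>a\<in>S. w a * ?E (\<lambda>x. (g x + h a x)\<^sup>2)) = V + H"
  proof -
    have "?E (\<lambda>x. (g x + h a x)\<^sup>2) = V + ?E (\<lambda>x. (h a x)\<^sup>2) + 2 * ?E (\<lambda>x. g x * h a x)" for a
      by (simp add: power2_sum V_def mult.assoc)
    then have "(\<Sum>a\<in>S. w a * ?E (\<lambda>x. (g x + h a x)\<^sup>2))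
        = (\<Sum>a\<in>S. w a) * V + H + 2 * (\<Sum>a\<in>S. w a * ?E (\<lambda>x. g x * h a x))"
      by (simp add: H_def distrib_left sum.distrib sum_distrib_right sum_distrib_left mult_ac)
    then show ?thesis by (simp add: vanish S)
  qed
  \<comment> \<open>The geometric mean of the factors \<open>16 / l * B\<close> and \<open>B\<close> is at most \<open>4 / l * B\<close>, because \<open>l \<le> 1\<close>;
    with the coefficient 8 below this is exactly what the term \<open>2 V H\<close> can pay for.\<close>
  have cross: "?E (\<lambda>x. (g x)\<^sup>2 * (h a x)\<^sup>2) \<le> 4 / l * B * V * ?E (\<lambda>x. (h a x)\<^sup>2)" if a: "a \<in> S" for a
  proof (rule power2_le_imp_le)
    let ?s = "?E (\<lambda>x. (h a x)\<^sup>2)"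
    have "(?E (\<lambda>x. (g x)\<^sup>2 * (h a x)\<^sup>2))\<^sup>2 \<le> ?E (\<lambda>x. g x ^ 4) * ?E (\<lambda>x. h a x ^ 4)"
      using pmf_Cauchy_Schwarz[OF q, of "\<lambda>x. (g x)\<^sup>2" "\<lambda>x. (h a x)\<^sup>2"] by (simp flip: power_mult)
    also have "\<dots> \<le> (16 / l * B * V\<^sup>2) * (B * ?s\<^sup>2)"
      by (intro mult_mono) (use g4 h4[OF a] B l(1) in \<open>auto simp: V_def\<close>)
    also have "\<dots> = B * (16 / l * B * V\<^sup>2 * ?s\<^sup>2)"
      by simp
    also have "\<dots> \<le> (B * (1 / l)) * (16 / l * B * V\<^sup>2 * ?s\<^sup>2)"
      by (rule mult_right_mono[OF \<open>B \<le> B * (1 / l)\<close>]) (use B l(1) in auto)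
    also have "\<dots> = (4 / l * B * V * ?s)\<^sup>2"
      by (simp add: power2_eq_square)
    finally show "(?E (\<lambda>x. (g x)\<^sup>2 * (h a x)\<^sup>2))\<^sup>2 \<le> (4 / l * B * V * ?s)\<^sup>2" .
  qed (use B l(1) V0 s0 in auto)
  \<comment> \<open>Conditional second moments can exceed their average \<open>H\<close> by no more than the factor \<open>1 / l\<close>.\<close>
  have diag: "(\<Sum>a\<in>S. w a * (?E (\<lambda>x. (h a x)\<^sup>2))\<^sup>2) \<le> 1 / l * H\<^sup>2"
  proof -
    let ?s = "\<lambda>a. ?E (\<lambda>x. (h a x)\<^sup>2)"
    have "(\<Sum>a\<in>S. w a * (?s a)\<^sup>2) \<le> (\<Sum>a\<in>S. 1 / l * ((w a * ?s a) * H))"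
    proof (rule sum_mono)
      fix a assume a: "a \<in> S"
      have "l * ?s a \<le> w a * ?s a"
        by (rule mult_right_mono[OF l(2)[OF a] s0])
      also have "\<dots> \<le> H"
        unfolding H_def by (rule member_le_sum[OF a]) (use S w0 s0 in auto)
      finally have "?s a \<le> 1 / l * H"
        using l(1) by (simp add: field_simps)
      from mult_left_mono[OF this, of "w a * ?s a"] w0[OF a] s0
      show "w a * (?s a)\<^sup>2 \<le> 1 / l * ((w a * ?s a) * H)"
        by (simp add: power2_eq_square mult_ac)
    qed
    also have "\<dots> = 1 / l * ((\<Sum>a\<in>S. w a * ?s a) * H)"
      by (simp only: sum_distrib_left sum_distrib_right)
    also have "\<dots> = 1 / l * H\<^sup>2"
      by (simp add: H_def power2_eq_square)
    finally show ?thesis .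
  qed
  \<comment> \<open>The binomial formula with \<open>4 u v ^ 3 \<le> 2 u\<^sup>2 v\<^sup>2 + 2 v ^ 4\<close>; the difference of the two sides
    is \<open>2 (v (u - v))\<^sup>2\<close>.\<close>
  have pointwise: "(u + v) ^ 4 \<le> u ^ 4 + 4 * (u ^ 3 * v) + 8 * (u\<^sup>2 * v\<^sup>2) + 3 * v ^ 4" for u v :: real
  proof -
    have "0 \<le> 2 * (v * (u - v))\<^sup>2" by simp
    then show ?thesis by (simp add: power2_eq_square power3_eq_cube power4_eq_xxxx algebra_simps)
  qed
  have "(\<Sum>a\<in>S. w a * ?E (\<lambda>x. (g x + h a x) ^ 4))
      \<le> (\<Sum>a\<in>S. w a * ?E (\<lambda>x. g x ^ 4) + 4 * (w a * ?E (\<lambda>x. g x ^ 3 * h a x))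
           + 8 * (w a * ?E (\<lambda>x. (g x)\<^sup>2 * (h a x)\<^sup>2)) + 3 * (w a * ?E (\<lambda>x. h a x ^ 4)))"
  proof (rule sum_mono)
    fix a assume a: "a \<in> S"
    have "?E (\<lambda>x. (g x + h a x) ^ 4)
        \<le> ?E (\<lambda>x. g x ^ 4 + 4 * (g x ^ 3 * h a x) + 8 * ((g x)\<^sup>2 * (h a x)\<^sup>2) + 3 * h a x ^ 4)"
      by (intro integral_mono) (auto intro: pointwise)
    also have "\<dots> = ?E (\<lambda>x. g x ^ 4) + 4 * ?E (\<lambda>x. g x ^ 3 * h a x)
        + 8 * ?E (\<lambda>x. (g x)\<^sup>2 * (h a x)\<^sup>2) + 3 * ?E (\<lambda>x. h a x ^ 4)"
      by simp
    finally show "w a * ?E (\<lambda>x. (g x + h a x) ^ 4)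
       \<le> w a * ?E (\<lambda>x. g x ^ 4) + 4 * (w a * ?E (\<lambda>x. g x ^ 3 * h a x))
           + 8 * (w a * ?E (\<lambda>x. (g x)\<^sup>2 * (h a x)\<^sup>2)) + 3 * (w a * ?E (\<lambda>x. h a x ^ 4))"
      using mult_left_mono[OF _ w0[OF a]] by (fastforce simp: algebra_simps)
  qed
  also have "\<dots> = ?E (\<lambda>x. g x ^ 4) + 8 * (\<Sum>a\<in>S. w a * ?E (\<lambda>x. (g x)\<^sup>2 * (h a x)\<^sup>2))
      + 3 * (\<Sum>a\<in>S. w a * ?E (\<lambda>x. h a x ^ 4))"
    using S(2) vanish[of "\<lambda>x. g x ^ 3"]
    by (simp add: sum.distrib flip: sum_distrib_left sum_distrib_right)
  also have "\<dots> \<le> 16 / l * B * V\<^sup>2 + 8 * (\<Sum>a\<in>S. w a * (4 / l * B * V * ?E (\<lambda>x. (h a x)\<^sup>2)))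
      + 3 * (\<Sum>a\<in>S. w a * (B * (?E (\<lambda>x. (h a x)\<^sup>2))\<^sup>2))"
    using g4 by (intro add_mono mult_left_mono sum_mono cross h4) (auto simp: V_def intro: w0)
  also have "\<dots> = 16 / l * B * V\<^sup>2 + 32 / l * B * V * H + 3 * B * (\<Sum>a\<in>S. w a * (?E (\<lambda>x. (h a x)\<^sup>2))\<^sup>2)"
    by (simp add: H_def sum_distrib_left mult_ac)
  also have "\<dots> \<le> 16 / l * B * V\<^sup>2 + 32 / l * B * V * H + 3 * B * (1 / l * H\<^sup>2)"
    using mult_left_mono[OF diag, of "3 * B"] B by simp
  also have "\<dots> \<le> 16 / l * B * V\<^sup>2 + 32 / l * B * V * H + 16 * B * (1 / l * H\<^sup>2)"
    using B l(1) V0 H0 by (intro add_mono mult_right_mono) auto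
  also have "\<dots> = 16 / l * B * (V + H)\<^sup>2"
    by (simp add: power2_sum algebra_simps)
  finally show ?thesis
    by (simp only: second)
qed

lemma expectation_Pi_pmf_insert:
  fixes f :: "('i \<Rightarrow> 'a) \<Rightarrow> real"
  assumes "finite A" "v \<notin> A" "finite (set_pmf (p v))" "finite (set_pmf (Pi_pmf A dflt p))"
  shows "measure_pmf.expectation (Pi_pmf (insert v A) dflt p) f
    = (\<Sum>a\<in>set_pmf (p v). pmf (p v) a * measure_pmf.expectation (Pi_pmf A dflt p) (\<lambda>x. f (x(v := a))))"
proof -
  have "measure_pmf.expectation (Pi_pmf (insert v A) dflt p) f
      = measure_pmf.expectation (pair_pmf (p v) (Pi_pmf A dflt p)) (\<lambda>(a, x). f (x(v := a)))"
    using assms(1,2) by (simp add: Pi_pmf_insert case_prod_beta')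
  also have "\<dots> = (\<Sum>(a, x)\<in>set_pmf (p v) \<times> set_pmf (Pi_pmf A dflt p).
      f (x(v := a)) * pmf (pair_pmf (p v) (Pi_pmf A dflt p)) (a, x))"
    using assms(3,4)
    by (subst integral_measure_pmf_real[where A = "set_pmf (p v) \<times> set_pmf (Pi_pmf A dflt p)"])
      (auto simp: case_prod_beta')
  also have "\<dots> = (\<Sum>a\<in>set_pmf (p v). \<Sum>x\<in>set_pmf (Pi_pmf A dflt p).
      pmf (p v) a * (f (x(v := a)) * pmf (Pi_pmf A dflt p) x))"
    by (subst sum.cartesian_product) (auto simp: pmf_pair intro!: sum.cong)
  also have "\<dots> = (\<Sum>a\<in>set_pmf (p v). pmf (p v) a * measure_pmf.expectation (Pi_pmf A dflt p) (\<lambda>x. f (x(v := a))))"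
    by (subst integral_measure_pmf_real[OF assms(4)]) (auto simp: sum_distrib_left)
  finally show ?thesis .
qed

lemma finite_set_Pi_pmf:
  assumes "finite A" "\<And>i. i \<in> A \<Longrightarrow> finite (set_pmf (p i))"
  shows "finite (set_pmf (Pi_pmf A dflt p))"
  using assms by (simp add: set_Pi_pmf finite_PiE_dflt)

text \<open>
  The point is that the constant does not depend on \<open>A\<close>. Fixing the new coordinate to \<open>a\<close> and
  subtracting the average over it writes \<open>h a\<close> as an average of discrete derivatives of \<open>f\<close>,
  so its degree is at most \<open>d - 1\<close> and the induction hypothesis gains the factor \<open>16 / l\<close>.
\<close>

lemma Bonami_hypercontractivity:
  fixes f :: "('i \<Rightarrow> 'a) \<Rightarrow> real"
  assumes "finite A" and "degree_le d f"
    and "\<And>i. i \<in> A \<Longrightarrow> finite (set_pmf (p i))"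
    and l: "0 < l" "l \<le> 1" "\<And>i a. i \<in> A \<Longrightarrow> a \<in> set_pmf (p i) \<Longrightarrow> l \<le> pmf (p i) a"
  shows "measure_pmf.expectation (Pi_pmf A dflt p) (\<lambda>x. f x ^ 4)
    \<le> (16 / l) ^ d * (measure_pmf.expectation (Pi_pmf A dflt p) (\<lambda>x. (f x)\<^sup>2))\<^sup>2"
  using assms(1,2,3) l(3)
proof (induction A arbitrary: d f rule: finite_induct)
  case empty
  have "1 \<le> (16 / l) ^ d"
    using l(1,2) by (intro one_le_power) (simp add: field_simps)
  from mult_right_mono[OF this, of "f (\<lambda>_. dflt) ^ 4"] show ?case
    by (simp flip: power_mult)
next
  case (insert v A)
  let ?S = "set_pmf (p v)" and ?q = "Pi_pmf A dflt p"
  define w where "w = pmf (p v)"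
  have S: "finite ?S" and sum_w: "(\<Sum>a\<in>?S. w a) = 1"
    using insert.prems(2) by (auto simp: w_def sum_pmf_eq_1)
  have q: "finite (set_pmf ?q)"
    using insert by (intro finite_set_Pi_pmf) auto
  define g where "g x = (\<Sum>b\<in>?S. w b * f (x(v := b)))" for x
  define h where "h a x = f (x(v := a)) - g x" for a x
  have h_eq: "h a x = (\<Sum>b\<in>?S. w b * (f (x(v := a)) - f (x(v := b))))" for a x
    using sum_w by (simp add: h_def g_def right_diff_distrib sum_subtractf flip: sum_distrib_right)
  \<comment> \<open>This is \<open>(16 / l) ^ (d - 1)\<close>, in a form that also makes sense for \<open>d = 0\<close>, when \<open>h = 0\<close>.\<close>
  define B where "B = (16 / l) ^ d / (16 / l)"
  have B: "0 \<le> B" "16 / l * B = (16 / l) ^ d"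
    using l(1) by (auto simp: B_def)
  have IH: "measure_pmf.expectation ?q (\<lambda>x. k x ^ 4) \<le> (16 / l) ^ e * (measure_pmf.expectation ?q (\<lambda>x. (k x)\<^sup>2))\<^sup>2"
    if "degree_le e k" for e k
    using insert.IH[OF that] insert.prems by blast
  have "(\<Sum>a\<in>?S. w a * measure_pmf.expectation ?q (\<lambda>x. (g x + h a x) ^ 4))
    \<le> 16 / l * B * (\<Sum>a\<in>?S. w a * measure_pmf.expectation ?q (\<lambda>x. (g x + h a x)\<^sup>2))\<^sup>2"
  proof (rule hypercontractive_step[OF S sum_w l(1) _ q _ B(1)])
    show "l \<le> w a" if "a \<in> ?S" for a
      using insert.prems(3) that by (auto simp: w_def)
    show "(\<Sum>a\<in>?S. w a * h a x) = 0" for x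
      using sum_w by (simp add: h_def right_diff_distrib sum_subtractf flip: sum_distrib_right)
        (simp add: g_def)
    have "degree_le d g"
      unfolding g_def by (intro degree_le_sum degree_le_cmult degree_le_fun_upd insert.prems)
    then show "measure_pmf.expectation ?q (\<lambda>x. g x ^ 4) \<le> 16 / l * B * (measure_pmf.expectation ?q (\<lambda>x. (g x)\<^sup>2))\<^sup>2"
      unfolding B(2) by (rule IH)
    show "measure_pmf.expectation ?q (\<lambda>x. h a x ^ 4) \<le> B * (measure_pmf.expectation ?q (\<lambda>x. (h a x)\<^sup>2))\<^sup>2" for a
    proof (cases d)
      case 0
      then have "f x = f y" for x y
        using insert.prems(1) degree_le_0_const by blast
      then have "h a x = 0" for x
        unfolding h_eq by (intro sum.neutral) auto
      then show ?thesis by simp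
    next
      case (Suc e)
      have "degree_le (d - 1) (h a)"
        unfolding h_eq by (intro degree_le_sum degree_le_cmult degree_le_diff insert.prems)
      moreover have "B = (16 / l) ^ (d - 1)"
        using l(1) by (simp add: B_def Suc)
      ultimately show ?thesis
        by (simp add: IH)
    qed
  qed
  moreover have "g x + h a x = f (x(v := a))" for a x
    by (simp add: h_def)
  ultimately show ?case
    unfolding expectation_Pi_pmf_insert[OF insert.hyps S q] w_def[symmetric] B(2) by simp
qed

section \<open>Weak convergence and unbounded functions\<close>

text \<open>
  Bounded second moments of \<open>f\<close> make \<open>f\<close> uniformly integrable: cutting \<open>f\<close> off at height \<open>C\<close>
  changes its expectation by at most \<open>E (f\<^sup>2) / C\<close>, uniformly along the sequence, and the
  truncated function is bounded and continuous.
\<close>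

lemma weak_conv_m_expectation_tendsto:
  fixes f :: "real \<Rightarrow> real"
  assumes conv: "weak_conv_m \<mu> M"
    and real: "\<And>n. real_distribution (\<mu> n)" "real_distribution M"
    and f: "continuous_on UNIV f" "\<And>x. 0 \<le> f x"
    and bound: "\<forall>\<^sub>F n in sequentially. integrable (\<mu> n) (\<lambda>x. (f x)\<^sup>2) \<and> integral\<^sup>L (\<mu> n) (\<lambda>x. (f x)\<^sup>2) \<le> K"
    and lim: "integrable M (\<lambda>x. (f x)\<^sup>2)"
  shows "(\<lambda>n. integral\<^sup>L (\<mu> n) f) \<longlonglongrightarrow> integral\<^sup>L M f"
proof -
  have meas: "f \<in> borel_measurable borel"
    by (rule borel_measurable_continuous_onI[OF f(1)])
  have tail: "0 \<le> integral\<^sup>L N f - integral\<^sup>L N (\<lambda>x. min (f x) C)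
      \<and> integral\<^sup>L N f - integral\<^sup>L N (\<lambda>x. min (f x) C) \<le> integral\<^sup>L N (\<lambda>x. (f x)\<^sup>2) / C"
    if N: "real_distribution N" and i2: "integrable N (\<lambda>x. (f x)\<^sup>2)" and C: "C > 0" for N C
  proof -
    interpret real_distribution N by fact
    have [measurable]: "f \<in> borel_measurable N"
      using meas by (simp cong: measurable_cong_sets)
    have i1: "integrable N f"
      by (rule square_integrable_imp_integrable[OF _ i2]) simp
    have imin: "integrable N (\<lambda>x. min (f x) C)"
      by (rule integrable_const_bound[where B = C]) (use f(2) C in auto)
    have "f x - min (f x) C \<le> (f x)\<^sup>2 / C" for x
    proof (cases "f x \<le> C")
      case False
      then have "C * f x \<le> f x * f x"
        using f(2) C by (intro mult_right_mono) auto
      then have "f x \<le> (f x)\<^sup>2 / C"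
        using C by (simp add: field_simps power2_eq_square)
      then show ?thesis using C False by auto
    qed (use C in auto)
    then have "integral\<^sup>L N (\<lambda>x. f x - min (f x) C) \<le> integral\<^sup>L N (\<lambda>x. (f x)\<^sup>2 / C)"
      using i1 i2 imin by (intro integral_mono) auto
    moreover have "0 \<le> integral\<^sup>L N (\<lambda>x. f x - min (f x) C)"
      by (intro integral_nonneg_AE) auto
    ultimately show ?thesis
      using i1 imin by simp
  qed
  define K' where "K' = max 1 (max K (integral\<^sup>L M (\<lambda>x. (f x)\<^sup>2)))"
  have K': "K' > 0" "K \<le> K'" "integral\<^sup>L M (\<lambda>x. (f x)\<^sup>2) \<le> K'"
    by (auto simp: K'_def)
  show ?thesis
  proof (rule LIMSEQ_I)
    fix e :: real assume e: "0 < e"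
    define C where "C = 3 * K' / e"
    have C: "C > 0" and KC: "K' / C = e / 3"
      using K' e by (auto simp: C_def)
    have "(\<lambda>n. integral\<^sup>L (\<mu> n) (\<lambda>x. min (f x) C)) \<longlonglongrightarrow> integral\<^sup>L M (\<lambda>x. min (f x) C)"
      using f C
      by (intro weak_conv_imp_integral_bdd_continuous_conv[OF real conv, where B = C])
        (auto intro!: continuous_intros simp: continuous_on_eq_continuous_at)
    then have "\<forall>\<^sub>F n in sequentially.
        dist (integral\<^sup>L (\<mu> n) (\<lambda>x. min (f x) C)) (integral\<^sup>L M (\<lambda>x. min (f x) C)) < e / 3"
      using e by (intro tendstoD) auto
    with bound have "\<forall>\<^sub>F n in sequentially. norm (integral\<^sup>L (\<mu> n) f - integral\<^sup>L M f) < e"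
    proof eventually_elim
      case (elim n)
      have "integral\<^sup>L (\<mu> n) (\<lambda>x. (f x)\<^sup>2) / C \<le> e / 3" "integral\<^sup>L M (\<lambda>x. (f x)\<^sup>2) / C \<le> e / 3"
        using elim K' C unfolding KC[symmetric] by (auto intro!: divide_right_mono)
      with tail[OF real(1) _ C, of n] tail[OF real(2) lim C] elim show ?case
        unfolding dist_real_def real_norm_def by linarith
    qed
    then show "\<exists>N. \<forall>n\<ge>N. norm (integral\<^sup>L (\<mu> n) f - integral\<^sup>L M f) < e"
      by (simp add: eventually_sequentially)
  qed
qed

section \<open>Moments of the normalized triangle count\<close>

lemma degree_le_T3: "degree_le 3 (T3 G)"
proof -
  have mono: "degree_le 3 (\<lambda>X. of_bool (X i = X j \<and> X j = X k))" for i j k :: nat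
    by (rule degree_le.junta[of "{i, j, k}"]) (auto simp: card_insert_if)
  show ?thesis
    unfolding T3_def case_prod_beta' by (intro degree_le_sum degree_le_cmult mono)
qed

lemma degree_le_Z3: "degree_le 3 (Z3 c G)"
proof -
  define m where "m = measure_pmf.expectation (coloring_pmf c G) (T3 G)"
  define s where "s = sqrt (measure_pmf.variance (coloring_pmf c G) (T3 G))"
  have "degree_le 3 (\<lambda>X. 1 / s * (T3 G X + (- m)))"
    by (intro degree_le_cmult degree_le.add degree_le_T3 degree_le_const)
  moreover have "Z3 c G = (\<lambda>X. 1 / s * (T3 G X + (- m)))"
    by (auto simp: Z3_def m_def s_def)
  ultimately show ?thesis by simp
qed

text \<open>
  The value is 1, except when the variance is 0: then \<^const>\<open>Z3\<close> is identically 0 because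
  division by 0 gives 0.
\<close>

lemma Z3_second_moment_le:
  "measure_pmf.expectation (coloring_pmf c G) (\<lambda>X. (Z3 c G X)\<^sup>2) \<le> 1"
  by (simp add: Z3_def power_divide)

text \<open>
  Two applications of hypercontractivity, with degrees 6 and 3; the exponent is
  \<open>12 = 6 + 2 * 3\<close>.
\<close>

lemma Z3_eighth_moment_le:
  assumes "c \<ge> 1" and "finite (pverts G)"
  shows "measure_pmf.expectation (coloring_pmf c G) (\<lambda>X. Z3 c G X ^ 8) \<le> (16 * real c) ^ 12"
proof -
  let ?E = "measure_pmf.expectation (coloring_pmf c G)"
  let ?Z = "Z3 c G"
  have hyp: "?E (\<lambda>X. f X ^ 4) \<le> (16 * real c) ^ d * (?E (\<lambda>X. (f X)\<^sup>2))\<^sup>2" if "degree_le d f" for d f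
    using Bonami_hypercontractivity[OF assms(2) that, of "\<lambda>_. pmf_of_set {1..c}" "1 / real c" undefined] assms
    by (simp add: coloring_pmf_def)
  have "?E (\<lambda>X. ?Z X ^ 8) = ?E (\<lambda>X. (?Z X * ?Z X) ^ 4)"
    by (simp add: power_mult_distrib flip: power_add)
  also have "\<dots> \<le> (16 * real c) ^ 6 * (?E (\<lambda>X. (?Z X * ?Z X)\<^sup>2))\<^sup>2"
    using hyp[OF degree_le_mult[OF degree_le_Z3 degree_le_Z3]] by simp
  also have "\<dots> = (16 * real c) ^ 6 * (?E (\<lambda>X. ?Z X ^ 4))\<^sup>2"
    by (simp add: power_mult_distrib flip: power_add)
  also have "\<dots> \<le> (16 * real c) ^ 6 * ((16 * real c) ^ 3 * 1)\<^sup>2"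
  proof (intro mult_left_mono power_mono)
    have "(?E (\<lambda>X. (?Z X)\<^sup>2))\<^sup>2 \<le> 1\<^sup>2"
      by (intro power_mono Z3_second_moment_le) simp
    then have "(16 * real c) ^ 3 * (?E (\<lambda>X. (?Z X)\<^sup>2))\<^sup>2 \<le> (16 * real c) ^ 3 * 1"
      by (intro mult_left_mono) auto
    with hyp[OF degree_le_Z3] show "?E (\<lambda>X. ?Z X ^ 4) \<le> (16 * real c) ^ 3 * 1"
      by (rule order_trans)
  qed auto
  also have "\<dots> = (16 * real c) ^ 12"
    by (simp flip: power_mult power_add)
  finally show ?thesis .
qed

theorem theorem1p3:
  fixes c :: nat and G :: "nat \<Rightarrow> nat pair_pre_digraph"
  assumes "c \<ge> 2"
    and "\<And>n. n \<ge> 1 \<Longrightarrow> pair_graph (G n)"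
    and "\<And>n. n \<ge> 1 \<Longrightarrow> pverts (G n) = {1..card (pverts (G n))}"
    and "\<And>n. n \<ge> 1 \<Longrightarrow> num_triangles (G n) \<ge> 1"
    and "weak_conv_m (\<lambda>n. distr (coloring_pmf c (G n)) borel (Z3 c (G n)))
           std_normal_distribution"
  shows "(\<lambda>n. measure_pmf.expectation (coloring_pmf c (G n)) (\<lambda>X. Z3 c (G n) X ^ 4))
           \<longlonglongrightarrow> 3"
proof -
  define \<mu> where "\<mu> n = distr (coloring_pmf c (G n)) borel (Z3 c (G n))" for n
  have real_\<mu>: "real_distribution (\<mu> n)" for n
    unfolding \<mu>_def real_distribution_def real_distribution_axioms_def
    by (auto intro: measure_pmf.prob_space_distr)
  have moment: "integral\<^sup>L (\<mu> n) (\<lambda>x. x ^ k)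
      = measure_pmf.expectation (coloring_pmf c (G n)) (\<lambda>X. Z3 c (G n) X ^ k)" for n k
    unfolding \<mu>_def by (subst integral_distr) auto
  have bound: "integrable (\<mu> n) (\<lambda>x. (x ^ 4)\<^sup>2) \<and> integral\<^sup>L (\<mu> n) (\<lambda>x. (x ^ 4)\<^sup>2) \<le> (16 * real c) ^ 12"
    if n: "n \<ge> 1" for n
  proof
    have fin: "finite (pverts (G n))"
      by (subst assms(3)[OF n]) simp
    have "finite (set_pmf (coloring_pmf c (G n)))"
      unfolding coloring_pmf_def using fin assms(1) by (intro finite_set_Pi_pmf) auto
    then show "integrable (\<mu> n) (\<lambda>x. (x ^ 4)\<^sup>2)"
      unfolding \<mu>_def by (subst integrable_distr_eq) (auto intro: integrable_measure_pmf_finite)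
    show "integral\<^sup>L (\<mu> n) (\<lambda>x. (x ^ 4)\<^sup>2) \<le> (16 * real c) ^ 12"
      using Z3_eighth_moment_le[OF _ fin, of c] assms(1) by (simp add: moment flip: power_mult)
  qed
  have "(\<lambda>n. integral\<^sup>L (\<mu> n) (\<lambda>x. x ^ 4)) \<longlonglongrightarrow> integral\<^sup>L std_normal_distribution (\<lambda>x. x ^ 4)"
  proof (rule weak_conv_m_expectation_tendsto[OF _ real_\<mu> real_dist_normal_dist])
    show "weak_conv_m \<mu> std_normal_distribution"
      unfolding \<mu>_def by (rule assms(5))
    show "\<forall>\<^sub>F n in sequentially. integrable (\<mu> n) (\<lambda>x. (x ^ 4)\<^sup>2)
        \<and> integral\<^sup>L (\<mu> n) (\<lambda>x. (x ^ 4)\<^sup>2) \<le> (16 * real c) ^ 12"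
      using bound by (auto simp: eventually_sequentially)
    show "integrable std_normal_distribution (\<lambda>x. (x ^ 4)\<^sup>2)"
      using integrable_std_normal_distribution_moment[of 8] by (simp flip: power_mult)
  qed (auto intro!: continuous_intros)
  moreover have "integral\<^sup>L std_normal_distribution (\<lambda>x. x ^ 4) = 3"
    using std_normal_distribution_even_moments(1)[of 2] by (simp add: fact_numeral)
  ultimately show ?thesis
    by (simp add: moment)
qed

end
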